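(* For each integer $n\ge 3$, let $L_1(n)$ be the critical length associated with $k=1$ and let $B_n$ be the corresponding bound (both defined in the context). Then $$\lim_{n\to\infty} L_1(n) = 0 \quad\text{and}\quad \lim_{n\to\infty} B_n = \infty.$$
   Context: For $n\ge 3$, the critical length $L_1=L_1(n)$ associated with $k=1$ is the unique real positive solution $L$ of the equation $$\left(1+L/2\right)^{2n-2}-(n-1)\left(1+L/2\right)^n-(n-1)^2\left(1+L/2\right)^{n-2}+n-1=0,$$ and $$B_n := \frac{(n-2)\left(1+\frac{L_1(n)}{2}\right)^{n-2}}{\left(1+\frac{L_1(n)}{2}\right)^{n-2}-1}.$$ ($B_n$ is the sharp upper bound, depending only on $n$, for the first nonzero Steklov eigenvalue of $n$-dimensional hypersurfaces of revolution with two boundary components each isometric to $\mathbb{S}^{n-1}$.) *)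

theory Defs
  imports Complex_Main
begin

text \<open>
  The definitions are meant for \<open>n \<ge> 3\<close>; smaller \<open>n\<close> get arbitrary values, which do not affect
  limits. In that range the natural-number subtractions in the exponents are exact.
\<close>

definition critical_length_eq :: "nat \<Rightarrow> real \<Rightarrow> bool" where
  "critical_length_eq n L \<longleftrightarrow>
     (1 + L / 2) ^ (2 * n - 2) - (real n - 1) * (1 + L / 2) ^ n
       - (real n - 1)\<^sup>2 * (1 + L / 2) ^ (n - 2) + real n - 1 = 0"

definition L1 :: "nat \<Rightarrow> real" where
  "L1 n = (THE L. L > 0 \<and> critical_length_eq n L)"

definition B :: "nat \<Rightarrow> real" where
  "B n = (real n - 2) * (1 + L1 n / 2) ^ (n - 2) / ((1 + L1 n / 2) ^ (n - 2) - 1)"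

end

theory Submission
  imports Defs "HOL-Analysis.Convex" "HOL-Real_Asymp.Real_Asymp"
begin

text \<open>
  Put \<open>x = 1 + L/2\<close>. Dividing the left-hand side of the equation by \<open>x ^ (n - 2)\<close> gives a function
  of \<open>x\<close> that is convex on \<open>{1..}\<close> and negative at \<open>1\<close>, so it has at most one zero beyond \<open>1\<close>. At
  any fixed \<open>a > 1\<close> the term \<open>a ^ n\<close> dominates, so for large \<open>n\<close> there is a zero in \<open>{1<..<a}\<close>;
  hence \<open>L1\<close> tends to \<open>0\<close>. Finally \<open>B n \<ge> n - 2\<close>, because \<open>t / (t - 1) \<ge> 1\<close> for \<open>t > 1\<close>.
\<close>

definition reduced_lhs :: "nat \<Rightarrow> real \<Rightarrow> real" where
  "reduced_lhs n x =
     x ^ n - (real n - 1) * x\<^sup>2 - (real n - 1)\<^sup>2 + (real n - 1) * inverse x ^ (n - 2)"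

lemma critical_length_eq_iff_reduced_lhs:
  assumes "n \<ge> 2" "L > 0"
  shows "critical_length_eq n L \<longleftrightarrow> reduced_lhs n (1 + L / 2) = 0"
proof -
  obtain k where k: "n = k + 2"
    using assms(1) by (metis add.commute le_Suc_ex)
  define x where "x = 1 + L / 2"
  have x: "x > 0"
    using assms(2) by (simp add: x_def)
  then have inv: "x ^ k * inverse x ^ k = 1"
    by (simp flip: power_mult_distrib)
  have "x ^ (2 * n - 2) - (real n - 1) * x ^ n - (real n - 1)\<^sup>2 * x ^ (n - 2) + real n - 1
      = x ^ k * (x ^ n - (real n - 1) * x\<^sup>2 - (real n - 1)\<^sup>2) + (real n - 1) * (x ^ k * inverse x ^ k)"
  proof -
    have "x ^ (2 * n - 2) = x ^ k * x ^ n" "x ^ n = x ^ k * x\<^sup>2" "n - 2 = k"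
      by (simp_all add: k mult_2 power2_eq_square flip: power_add)
    then show ?thesis
      unfolding inv by (simp add: right_diff_distrib mult_ac)
  qed
  also have "\<dots> = x ^ k * reduced_lhs n x"
    by (simp add: reduced_lhs_def k algebra_simps)
  finally show ?thesis
    using x by (simp add: critical_length_eq_def flip: x_def)
qed

lemma reduced_lhs_1_neg:
  assumes "n \<ge> 3"
  shows "reduced_lhs n 1 < 0"
proof -
  \<comment> \<open>At \<open>1\<close> the two terms linear in \<open>real n - 1\<close> cancel,
    leaving \<open>1 - (real n - 1)\<^sup>2\<close>.\<close>
  have "1 < (real n - 1)\<^sup>2"
    using assms by (intro one_less_power) auto
  then show ?thesis
    by (simp add: reduced_lhs_def)
qed

text \<open>The derivative is again a multiple of a power of \<open>inverse x\<close>, without a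
  truncated exponent \<open>m - 1\<close>, so the rule can be applied twice in succession.\<close>

lemma DERIV_inverse_power [derivative_intros]:
  fixes x :: real
  assumes "x \<noteq> 0"
  shows "((\<lambda>x. inverse x ^ m) has_real_derivative - (real m * inverse x ^ Suc m)) (at x)"
  by (rule derivative_eq_intros refl assms)+ (cases m; simp add: mult_ac)

text \<open>The only negative term of the second derivative is the constant
  \<open>- 2 * (n - 1)\<close>. For \<open>x \<ge> 1\<close> it is absorbed by
  \<open>n * (n - 1) * x ^ (n - 2)\<close>.\<close>

lemma convex_on_reduced_lhs:
  assumes "n \<ge> 2"
  shows "convex_on {1..} (reduced_lhs n)"
proof -
  obtain k where k: "n = k + 2"
    using assms by (metis add.commute le_Suc_ex)
  define c where "c = real k + 1"
  have c: "c \<ge> 1"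
    by (simp add: c_def)
  define f where "f = (\<lambda>x::real. x ^ (k+2) - c * x\<^sup>2 - c\<^sup>2 + c * inverse x ^ k)"
  define f' where "f' = (\<lambda>x::real. (c+1) * x ^ (k+1) - 2 * c * x - c * real k * inverse x ^ (k+1))"
  \<comment> \<open>The last factor \<open>c\<close> is the exponent \<open>k + 1\<close> of
    \<open>inverse x\<close> in \<open>f'\<close>.\<close>
  define f'' where "f'' = (\<lambda>x::real. (c+1) * c * x ^ k - 2 * c + c * real k * c * inverse x ^ (k+2))"
  have 1: "(f has_real_derivative f' x) (at x)" if "x \<in> {1..}" for x
    unfolding f_def f'_def
    by (rule derivative_eq_intros refl)+ (use that in \<open>auto simp: c_def algebra_simps\<close>)
  have 2: "(f' has_real_derivative f'' x) (at x)" if "x \<in> {1..}" for x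
    unfolding f''_def f'_def
    by (rule derivative_eq_intros refl)+ (use that in \<open>auto simp: c_def algebra_simps\<close>)
  have 3: "f'' x \<ge> 0" if "x \<in> {1..}" for x
  proof -
    have "(c+1) * c * x ^ k \<ge> (2 * c) * 1"
      using that c by (intro mult_mono mult_right_mono) auto
    moreover have "c * real k * c * inverse x ^ (k+2) \<ge> 0"
      using that c by auto
    ultimately show ?thesis
      by (simp add: f''_def)
  qed
  have "convex_on {1..} f"
    using 1 2 3 by (intro f''_ge0_imp_convex) auto
  also have "f = reduced_lhs n"
    by (simp add: fun_eq_iff f_def reduced_lhs_def k c_def add.commute)
  finally show ?thesis .
qed

text \<open>The smaller of two zeros would be a convex combination of \<open>a\<close> and the
  larger one, with positive weight on \<open>a\<close>; convexity would make \<open>f\<close>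
  negative there.\<close>

lemma convex_on_zero_unique:
  fixes f :: "real \<Rightarrow> real"
  assumes convex: "convex_on {a..} f" and neg: "f a < 0"
    and x: "a < x" "f x = 0" and y: "a < y" "f y = 0"
  shows "x = y"
proof -
  have no_zero: False if "a < u" "u < v" "f u = 0" "f v = 0" for u v
  proof -
    define t where "t = (u - a) / (v - a)"
    have t: "0 < t" "t < 1"
      using that by (auto simp: t_def)
    have "t * (v - a) = u - a"
      using that by (simp add: t_def)
    then have u: "u = (1 - t) * a + t * v"
      by (simp add: algebra_simps)
    have "f u \<le> (1 - t) * f a + t * f v"
      using convex_onD[OF convex, of t a v] t that u by simp
    with t neg that show False
      by (simp add: mult_less_0_iff zero_le_mult_iff)
  qed
  show ?thesis
    using no_zero[of x y] no_zero[of y x] x y by (cases x y rule: linorder_cases) auto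
qed

text \<open>Convexity yields uniqueness only, so a root has to be supplied to evaluate the definite
  description.\<close>

lemma L1_eqI:
  assumes "n \<ge> 3" "L > 0" "critical_length_eq n L"
  shows "L1 n = L"
  unfolding L1_def
proof (rule the_equality)
  fix M :: real
  assume M: "M > 0 \<and> critical_length_eq n M"
  have "1 + M / 2 = 1 + L / 2"
    by (rule convex_on_zero_unique[OF convex_on_reduced_lhs reduced_lhs_1_neg])
       (use assms M in \<open>auto simp flip: critical_length_eq_iff_reduced_lhs\<close>)
  then show "M = L"
    by simp
qed (use assms in auto)

lemma eventually_reduced_lhs_pos:
  assumes "a > 1"
  shows "eventually (\<lambda>n. reduced_lhs n a > 0) sequentially"
proof -
  \<comment> \<open>The term with \<open>inverse a\<close> is nonnegative and can be left out of the
    asymptotic comparison.\<close>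
  have "eventually (\<lambda>n. a ^ n - (real n - 1) * a\<^sup>2 - (real n - 1)\<^sup>2 > 0) sequentially"
    using assms by real_asymp
  then show ?thesis
    using eventually_ge_at_top[of 1]
  proof eventually_elim
    case (elim n)
    have "(real n - 1) * inverse a ^ (n - 2) \<ge> 0"
      using elim assms by simp
    with elim show ?case
      by (simp add: reduced_lhs_def)
  qed
qed

lemma eventually_L1_between:
  assumes "e > 0"
  shows "eventually (\<lambda>n. 0 < L1 n \<and> L1 n < e) sequentially"
proof -
  have "eventually (\<lambda>n. reduced_lhs n (1 + e / 2) > 0) sequentially"
    using assms by (intro eventually_reduced_lhs_pos) auto
  then show ?thesis
    using eventually_ge_at_top[of 3]
  proof eventually_elim
    case (elim n)
    have "continuous_on {1..1 + e / 2} (reduced_lhs n)"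
      unfolding reduced_lhs_def by (intro continuous_intros) auto
    then obtain x where x: "1 \<le> x" "x \<le> 1 + e / 2" "reduced_lhs n x = 0"
      using IVT'[of "reduced_lhs n" 1 0 "1 + e / 2"] elim reduced_lhs_1_neg[of n] assms by auto
    \<comment> \<open>The signs at both endpoints are strict, so the root is interior; this gives
      both strict bounds on \<open>L1 n\<close>.\<close>
    moreover have "x \<noteq> 1" "x \<noteq> 1 + e / 2"
      using x elim reduced_lhs_1_neg[of n] by auto
    moreover have "L1 n = 2 * (x - 1)"
      using elim calculation
      by (intro L1_eqI) (auto simp: critical_length_eq_iff_reduced_lhs diff_divide_distrib)
    ultimately show ?case
      by auto
  qed
qed

lemma B_ge:
  assumes "n \<ge> 3" "L1 n > 0"
  shows "B n \<ge> real n - 2"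
proof -
  define t where "t = (1 + L1 n / 2) ^ (n - 2)"
  \<comment> \<open>Since \<open>n \<ge> 3\<close>, the exponent is positive, and so is the
    denominator \<open>t - 1\<close>.\<close>
  have "t > 1"
    unfolding t_def using assms by (intro one_less_power) auto
  then have "(real n - 2) * (t - 1) \<le> (real n - 2) * t"
    using assms by (intro mult_left_mono) auto
  with \<open>t > 1\<close> have "real n - 2 \<le> (real n - 2) * t / (t - 1)"
    by (simp add: pos_le_divide_eq)
  then show ?thesis
    by (simp add: B_def t_def)
qed

theorem proposition5: "(L1 \<longlonglongrightarrow> 0) \<and> filterlim B at_top sequentially"
proof
  show "L1 \<longlonglongrightarrow> 0"
  proof (rule tendstoI)
    fix e :: real
    assume "e > 0"
    from eventually_L1_between[OF this] show "eventually (\<lambda>n. dist (L1 n) 0 < e) sequentially"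
      by eventually_elim auto
  qed
  have "eventually (\<lambda>n. real n - 2 \<le> B n) sequentially"
    \<comment> \<open>The instance \<open>e = 1\<close> supplies \<open>L1 n > 0\<close> for large
      \<open>n\<close>, as \<open>B_ge\<close> requires.\<close>
    using eventually_L1_between[OF zero_less_one] eventually_ge_at_top[of 3]
    by eventually_elim (auto intro: B_ge)
  moreover have "filterlim (\<lambda>n. real n - 2) at_top sequentially"
    by real_asymp
  ultimately show "filterlim B at_top sequentially"
    by (rule filterlim_at_top_mono[rotated])
qed

end
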